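(* Let $O$ be a unique sink orientation of $Q_n$, let $i\in[n]$, and let $P$ be an $i$-phase of $O$. Let $f$ be the minimal face of $Q_n$ such that every edge of $P$ is an $i$-edge of $f$. Then, for all dimensions $j\in[n]\setminus\dim(f)$ and all vertices $v,w$ that are endpoints of edges of $P$, we have $O(v)_j=O(w)_j$.
   Context: The $n$-cube $Q_n$ is the graph on $\{0,1\}^n$ where two vertices are adjacent iff they differ in exactly one coordinate; an edge whose endpoints differ in coordinate $i$ is an $i$-edge, and $E_i$ is the set of $i$-edges. A face of $Q_n$ is given by a string $f\in\{0,1,*\}^n$ and is the induced subgraph on all $v$ with $v_i=f_i$ or $f_i=*$ for every $i$; $\dim(f)=\{i: f_i=*\}$ is the set of dimensions spanned by $f$. An orientation is a function $O:\{0,1\}^n\to\{0,1\}^n$ (outmap) such that $O(v)_i\ne O(v')_i$ whenever $v,v'$ differ exactly in coordinate $i$; $O(v)_i=1$ means the $i$-edge at $v$ is outgoing from $v$, and $O(v)_i=0$ means it is incoming. $O$ is a unique sink orientation (USO) if every face contains exactly one vertex with no outgoing edges inside the face. Phases: let $O$ be a USO. Two $i$-edges $e,e'\in E_i$ are in direct phase if there exist $v\in e$, $w\in e'$ such that $O(v)_j=O(w)_j$ for all $j\neq i$ with $v_j\ne w_j$. Two $i$-edges are in phase if they are linked by a finite sequence of $i$-edges in which consecutive edges are in direct phase. An $i$-phase is an equivalence class of $E_i$ under this relation. *)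

theory Defs
  imports Main
begin

text \<open>
  Coordinates are the elements of a finite type \<open>'n\<close>, so \<open>n\<close> is \<open>CARD('n)\<close>. The values \<open>0\<close> and \<open>1\<close>
  are \<^const>\<open>False\<close> and \<^const>\<open>True\<close>; in a face, \<^const>\<open>None\<close> stands for \<open>*\<close>.
\<close>

type_synonym 'n vertex = "'n \<Rightarrow> bool"
type_synonym 'n edge = "'n vertex set"
type_synonym 'n face = "'n \<Rightarrow> bool option"
type_synonym 'n outmap = "'n vertex \<Rightarrow> 'n vertex"

definition differ_exactly_in :: "'n vertex \<Rightarrow> 'n vertex \<Rightarrow> 'n \<Rightarrow> bool" where
  "differ_exactly_in v w i \<longleftrightarrow> {j. v j \<noteq> w j} = {i}"

definition cube_edges :: "'n \<Rightarrow> 'n edge set" where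
  "cube_edges i = {{v, w} | v w. differ_exactly_in v w i}"

definition face_vertices :: "'n face \<Rightarrow> 'n vertex set" where
  "face_vertices f = {v. \<forall>i. f i = Some (v i) \<or> f i = None}"

definition face_dim :: "'n face \<Rightarrow> 'n set" where
  "face_dim f = {i. f i = None}"

definition face_edges :: "'n face \<Rightarrow> 'n \<Rightarrow> 'n edge set" where
  "face_edges f i = {e \<in> cube_edges i. e \<subseteq> face_vertices f}"

definition orientation :: "'n outmap \<Rightarrow> bool" where
  "orientation \<O> \<longleftrightarrow> (\<forall>v w i. differ_exactly_in v w i \<longrightarrow> \<O> v i \<noteq> \<O> w i)"

definition is_sink_in :: "'n outmap \<Rightarrow> 'n face \<Rightarrow> 'n vertex \<Rightarrow> bool" where
  "is_sink_in \<O> f v \<longleftrightarrow>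
     v \<in> face_vertices f \<and> (\<forall>i. \<forall>e \<in> face_edges f i. v \<in> e \<longrightarrow> \<not> \<O> v i)"

definition uso :: "'n outmap \<Rightarrow> bool" where
  "uso \<O> \<longleftrightarrow> orientation \<O> \<and> (\<forall>f. \<exists>!v. is_sink_in \<O> f v)"

definition direct_phase :: "'n outmap \<Rightarrow> 'n \<Rightarrow> 'n edge rel" where
  "direct_phase \<O> i =
     {(e, e'). e \<in> cube_edges i \<and> e' \<in> cube_edges i \<and>
        (\<exists>v\<in>e. \<exists>w\<in>e'. \<forall>j. j \<noteq> i \<and> v j \<noteq> w j \<longrightarrow> \<O> v j = \<O> w j)}"

text \<open>
  The restriction to \<^term>\<open>cube_edges i\<close> is needed because \<^const>\<open>rtrancl\<close> also relates every
  set of vertices that is not an \<open>i\<close>-edge to itself.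
\<close>

definition in_phase :: "'n outmap \<Rightarrow> 'n \<Rightarrow> 'n edge rel" where
  "in_phase \<O> i = (direct_phase \<O> i)\<^sup>* \<inter> cube_edges i \<times> cube_edges i"

definition phases :: "'n outmap \<Rightarrow> 'n \<Rightarrow> 'n edge set set" where
  "phases \<O> i = cube_edges i // in_phase \<O> i"

text \<open>
  Faces are ordered by inclusion of their vertex sets. The least face and a minimal face coincide
  here, as shown below.
\<close>

definition minimal_face :: "'n \<Rightarrow> 'n edge set \<Rightarrow> 'n face \<Rightarrow> bool" where
  "minimal_face i P f \<longleftrightarrow> P \<subseteq> face_edges f i \<and>
     (\<forall>g. P \<subseteq> face_edges g i \<and> face_vertices g \<subseteq> face_vertices f \<longrightarrow> g = f)"

lemma equiv_in_phase: "equiv (cube_edges i) (in_phase \<O> i)"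
proof (rule equivI)
  show "in_phase \<O> i \<subseteq> cube_edges i \<times> cube_edges i"
    by (auto simp: in_phase_def)
  show "refl_on (cube_edges i) (in_phase \<O> i)"
    by (auto simp: in_phase_def refl_on_def)
  have "sym (direct_phase \<O> i)"
  proof (rule symI)
    fix e e' assume "(e, e') \<in> direct_phase \<O> i"
    then obtain v w where "e \<in> cube_edges i" "e' \<in> cube_edges i" "v \<in> e" "w \<in> e'"
      and "\<And>j. j \<noteq> i \<Longrightarrow> v j \<noteq> w j \<Longrightarrow> \<O> v j = \<O> w j"
      unfolding direct_phase_def by blast
    then have "\<forall>j. j \<noteq> i \<and> w j \<noteq> v j \<longrightarrow> \<O> w j = \<O> v j" by metis
    then show "(e', e) \<in> direct_phase \<O> i"
      unfolding direct_phase_def using \<open>e \<in> cube_edges i\<close> \<open>e' \<in> cube_edges i\<close> \<open>v \<in> e\<close> \<open>w \<in> e'\<close>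
      by blast
  qed
  then show "sym (in_phase \<O> i)"
    unfolding in_phase_def by (intro sym_Int sym_rtrancl) (simp_all add: sym_def)
  show "trans (in_phase \<O> i)"
    unfolding in_phase_def by (auto simp: trans_def)
qed

lemma face_vertices_nonempty: "face_vertices f \<noteq> {}"
proof -
  have "(\<lambda>i. f i = Some True) \<in> face_vertices f"
    unfolding face_vertices_def mem_Collect_eq
  proof (rule allI)
    fix i show "f i = Some (f i = Some True) \<or> f i = None" by (cases "f i") auto
  qed
  then show ?thesis by blast
qed

lemma face_verticesD: "v \<in> face_vertices f \<Longrightarrow> f k = Some (v k) \<or> f k = None"
  unfolding face_vertices_def mem_Collect_eq by (rule spec)

lemma face_verticesI: "(\<And>k. f k = Some (v k) \<or> f k = None) \<Longrightarrow> v \<in> face_vertices f"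
  unfolding face_vertices_def mem_Collect_eq by (rule allI)

lemma face_vertices_subsetD:
  assumes sub: "face_vertices f \<subseteq> face_vertices g"
  shows "g i = None \<or> g i = f i"
proof (cases "g i")
  case (Some b)
  obtain v where v: "v \<in> face_vertices f" using face_vertices_nonempty by blast
  have "f i = Some b"
  proof (rule ccontr)
    assume ne: "f i \<noteq> Some b"
    define w where "w = v(i := \<not> b)"
    have "w \<in> face_vertices f"
    proof (rule face_verticesI)
      fix k show "f k = Some (w k) \<or> f k = None"
        using face_verticesD[OF v, of k] ne by (cases "f k") (auto simp: w_def)
    qed
    with sub have "w \<in> face_vertices g" by blast
    from face_verticesD[OF this, of i] Some show False by (simp add: w_def)
  qed
  with Some show ?thesis by simp
qed simp

lemma face_vertices_inject: "face_vertices f = face_vertices g \<Longrightarrow> f = g"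
  by (rule ext) (metis face_vertices_subsetD order_refl)

lemma ex1_minimal_face:
  assumes "P \<in> phases \<O> i"
  shows "\<exists>!f. minimal_face i P f"
    and "minimal_face i P f \<Longrightarrow> P \<subseteq> face_edges g i \<Longrightarrow> face_vertices f \<subseteq> face_vertices g"
proof -
  have sub: "P \<subseteq> cube_edges i" and ne: "P \<noteq> {}"
    using in_quotient_imp_subset[OF equiv_in_phase assms[unfolded phases_def]]
      in_quotient_imp_non_empty[OF equiv_in_phase assms[unfolded phases_def]] .
  obtain v0 where v0: "v0 \<in> \<Union>P"
  proof -
    obtain e where "e \<in> P" using ne by blast
    moreover from this sub obtain v w where "e = {v, w}" unfolding cube_edges_def by blast
    ultimately show thesis using that by blast
  qed
  define h where "h = (\<lambda>k. if \<forall>v\<in>\<Union>P. v k = v0 k then Some (v0 k) else None)"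
  have hP: "P \<subseteq> face_edges h i"
  proof
    fix e assume e: "e \<in> P"
    have "e \<subseteq> face_vertices h"
    proof (intro subsetI face_verticesI)
      fix v k assume "v \<in> e"
      with e have "v \<in> \<Union>P" by blast
      then show "h k = Some (v k) \<or> h k = None" unfolding h_def by (auto simp del: Union_iff)
    qed
    with e sub show "e \<in> face_edges h i" by (auto simp: face_edges_def)
  qed
  have least: "face_vertices h \<subseteq> face_vertices g" if g: "P \<subseteq> face_edges g i" for g
  proof -
    have V: "v \<in> face_vertices g" if "v \<in> \<Union>P" for v
      using g that by (auto simp: face_edges_def)
    have gh: "g k = None \<or> g k = h k" for k
    proof (cases "g k")
      case (Some b)
      then have "v k = b" if "v \<in> \<Union>P" for v
        using face_verticesD[OF V[OF that], of k] by simp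
      with v0 have "\<forall>v\<in>\<Union>P. v k = v0 k" "v0 k = b" by blast+
      then have "h k = Some b" unfolding h_def by (auto simp del: Union_iff)
      with Some show ?thesis by simp
    qed simp
    show ?thesis
    proof (intro subsetI face_verticesI)
      fix u k assume "u \<in> face_vertices h"
      then show "g k = Some (u k) \<or> g k = None"
        using face_verticesD[of u h k] gh[of k] by auto
    qed
  qed
  have h: "minimal_face i P h"
    unfolding minimal_face_def
    using hP least by (intro conjI allI impI face_vertices_inject subset_antisym) simp_all
  have uniq: "f = h" if "minimal_face i P f" for f
    using that hP least unfolding minimal_face_def by blast
  show "\<exists>!f. minimal_face i P f" using h uniq by blast
  show "minimal_face i P f \<Longrightarrow> P \<subseteq> face_edges g i \<Longrightarrow> face_vertices f \<subseteq> face_vertices g"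
    using uniq least by blast
qed

end

theory Submission imports Defs begin

text \<open>
  In a USO every outmap pattern is attained exactly once in every face. Suppose that \<open>v\<close> and \<open>w\<close>
  witness that two edges of \<open>P\<close> are in direct phase, that \<open>P\<close> lies on one side of dimension \<open>j\<close>,
  but that \<open>v\<close> and \<open>w\<close> disagree on the orientation of their \<open>j\<close>-edges. In the face spanned by
  \<open>v\<close>, \<open>w\<close> and the dimensions \<open>i\<close> and \<open>j\<close>, take the vertex \<open>y\<close> with the outmap of \<open>v\<close> except at
  \<open>j\<close>. By uniqueness \<open>y\<close> lies on the other side of \<open>j\<close>. But away from \<open>i\<close> it agrees with \<open>w\<close>
  wherever \<open>y\<close> and \<open>w\<close> may differ, so the \<open>i\<close>-edge of \<open>y\<close> belongs to \<open>P\<close>, a contradiction.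
\<close>

lemma differ_exactly_in_flip: "differ_exactly_in v (v(k := \<not> v k)) k"
  by (auto simp: differ_exactly_in_def)

lemma flip_edge_in_cube_edges: "{v, v(k := \<not> v k)} \<in> cube_edges k"
  unfolding cube_edges_def mem_Collect_eq
  by (rule exI, rule exI, rule conjI[OF refl differ_exactly_in_flip])

lemma cube_edge_endpoints_agree:
  assumes "e \<in> cube_edges i" "v \<in> e" "w \<in> e" "k \<noteq> i"
  shows "v k = w k"
proof -
  obtain a b where e: "e = {a, b}" and ab: "differ_exactly_in a b i"
    using assms(1) unfolding cube_edges_def by blast
  have "a k = b k" using ab assms(4) unfolding differ_exactly_in_def by blast
  with e assms(2,3) show ?thesis by blast
qed

text \<open>At a vertex \<open>x\<close> of the face, each dimension of \<open>D\<close> contributes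
  an edge of the face, and no other dimension does, since both endpoints would equal
  \<open>b\<close> there. This turns the edge-based notion of a sink into a condition on
  coordinates.\<close>

lemma is_sink_in_span_iff:
  "is_sink_in \<O> (\<lambda>k. if k \<in> D then None else Some (b k)) x \<longleftrightarrow>
     (\<forall>k. k \<notin> D \<longrightarrow> x k = b k) \<and> (\<forall>k\<in>D. \<not> \<O> x k)"
proof -
  let ?f = "\<lambda>k. if k \<in> D then None else Some (b k)"
  have face: "y \<in> face_vertices ?f \<longleftrightarrow> (\<forall>k. k \<notin> D \<longrightarrow> y k = b k)" for y
    by (auto simp: face_vertices_def)
  have edge: "(\<exists>e\<in>face_edges ?f k. x \<in> e) \<longleftrightarrow> k \<in> D" if x: "x \<in> face_vertices ?f" for k
  proof
    assume "\<exists>e\<in>face_edges ?f k. x \<in> e"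
    then obtain u v where uv: "differ_exactly_in u v k"
      "u \<in> face_vertices ?f" "v \<in> face_vertices ?f"
      by (auto simp: face_edges_def cube_edges_def)
    from uv(1) have "u k \<noteq> v k" by (auto simp: differ_exactly_in_def)
    moreover have "u k = v k" if "k \<notin> D"
      using face[THEN iffD1, rule_format, OF uv(2) that] face[THEN iffD1, rule_format, OF uv(3) that]
      by simp
    ultimately show "k \<in> D" by metis
  next
    assume "k \<in> D"
    with x have "x(k := \<not> x k) \<in> face_vertices ?f" by (auto simp: face)
    with x have "{x, x(k := \<not> x k)} \<in> face_edges ?f k"
      by (simp add: face_edges_def flip_edge_in_cube_edges)
    then show "\<exists>e\<in>face_edges ?f k. x \<in> e" by (rule bexI[rotated]) simp
  qed
  have "is_sink_in \<O> ?f x \<longleftrightarrow>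
      x \<in> face_vertices ?f \<and> (\<forall>k. (\<exists>e\<in>face_edges ?f k. x \<in> e) \<longrightarrow> \<not> \<O> x k)"
    unfolding is_sink_in_def by blast
  also have "\<dots> \<longleftrightarrow> x \<in> face_vertices ?f \<and> (\<forall>k. k \<in> D \<longrightarrow> \<not> \<O> x k)"
    by (intro conj_cong refl) (simp only: edge)
  finally show ?thesis by (simp only: face Ball_def)
qed

text \<open>Induction on the finite set \<open>S\<close> of dimensions prescribed as outgoing; the
  empty set is the USO property itself. \<open>D\<close> and \<open>b\<close> stay arbitrary because
  the step passes to the two facets of the face.\<close>

lemma uso_ex1_pattern:
  fixes \<O> :: "('n::finite) outmap"
  assumes uso: "uso \<O>"
  shows "\<exists>!x. (\<forall>k. k \<notin> D \<longrightarrow> x k = b k) \<and> (\<forall>k\<in>D. \<O> x k = s k)"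
proof -
  have "\<exists>!x. (\<forall>k. k \<notin> D \<longrightarrow> x k = b k) \<and> (\<forall>k\<in>D. \<O> x k = (k \<in> S))" for S D b
    using finite[of S]
  proof (induction S arbitrary: D b rule: finite_induct)
    case empty
    have "\<exists>!x. is_sink_in \<O> (\<lambda>k. if k \<in> D then None else Some (b k)) x"
      using uso unfolding uso_def by blast
    then show ?case by (simp add: is_sink_in_span_iff)
  next
    case (insert k S)
    show ?case
    proof (cases "k \<in> D")
      case False
      then have "(\<forall>l\<in>D. \<O> x l = (l \<in> insert k S)) \<longleftrightarrow> (\<forall>l\<in>D. \<O> x l = (l \<in> S))" for x
        by auto
      then show ?thesis using insert.IH[of D b] by simp
    next
      case True
      \<comment> \<open>Exactly one of the two vertices with pattern \<open>S\<close> in the facets across \<open>k\<close> has its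
        \<open>k\<close>-edge incoming; the other one realizes \<open>insert k S\<close>.\<close>
      define Q where "Q x \<longleftrightarrow>
        (\<forall>l. l \<notin> D \<longrightarrow> x l = b l) \<and> (\<forall>l\<in>D - {k}. \<O> x l = (l \<in> S))" for x
      have facet: "\<exists>!x. Q x \<and> x k = c" for c
      proof -
        have "(\<forall>l. l \<notin> D - {k} \<longrightarrow> x l = (b(k := c)) l) \<and> (\<forall>l\<in>D - {k}. \<O> x l = (l \<in> S)) \<longleftrightarrow>
            Q x \<and> x k = c" for x
          using True unfolding Q_def by auto
        then show ?thesis using insert.IH[of "D - {k}" "b(k := c)"] by simp
      qed
      have "(\<forall>l. l \<notin> D \<longrightarrow> x l = b l) \<and> (\<forall>l\<in>D. \<O> x l = (l \<in> S)) \<longleftrightarrow> Q x \<and> \<not> \<O> x k" for x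
        using True insert.hyps unfolding Q_def by auto
      with insert.IH[of D b] have whole: "\<exists>!x. Q x \<and> \<not> \<O> x k" by simp
      have new: "(\<forall>l. l \<notin> D \<longrightarrow> x l = b l) \<and> (\<forall>l\<in>D. \<O> x l = (l \<in> insert k S)) \<longleftrightarrow>
          Q x \<and> \<O> x k" for x
        using True insert.hyps unfolding Q_def by auto
      have "\<exists>!x. Q x \<and> \<O> x k"
        using facet[of True] facet[of False] whole by (metis (full_types))
      then show ?thesis by (simp only: new)
    qed
  qed
  from this[of D b "{k. s k}"] show ?thesis by simp
qed

text \<open>The vertices \<open>w\<close> and \<open>y\<close> witness that their
  \<open>i\<close>-edges are in direct phase, and \<open>P\<close> is a full equivalence
  class.\<close>

lemma phase_closed:
  assumes P: "P \<in> phases \<O> i" and w: "w \<in> \<Union>P"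
    and agree: "\<And>k. k \<noteq> i \<Longrightarrow> w k \<noteq> y k \<Longrightarrow> \<O> w k = \<O> y k"
  shows "y \<in> \<Union>P"
proof -
  obtain e where e: "e \<in> P" "w \<in> e" using w by blast
  let ?e = "{y, y(i := \<not> y i)}"
  have cube: "e \<in> cube_edges i"
    using e(1) in_quotient_imp_subset[OF equiv_in_phase P[unfolded phases_def]] by blast
  have "(e, ?e) \<in> direct_phase \<O> i"
    unfolding direct_phase_def using e(2) agree cube flip_edge_in_cube_edges[of y i] by blast
  then have "(e, ?e) \<in> in_phase \<O> i"
    unfolding in_phase_def using cube flip_edge_in_cube_edges[of y i] by blast
  then have "?e \<in> P"
    by (rule in_quotient_imp_closed[OF equiv_in_phase P[unfolded phases_def] e(1)])
  then show ?thesis by blast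
qed

lemma direct_phase_agree_outside_span:
  fixes \<O> :: "('n::finite) outmap"
  assumes uso: "uso \<O>" and P: "P \<in> phases \<O> i"
    and j: "j \<noteq> i" and const: "\<And>x. x \<in> \<Union>P \<Longrightarrow> x j = c"
    and v: "v \<in> \<Union>P" and w: "w \<in> \<Union>P"
    and agree: "\<And>k. k \<noteq> i \<Longrightarrow> v k \<noteq> w k \<Longrightarrow> \<O> v k = \<O> w k"
  shows "\<O> v j = \<O> w j"
proof (rule ccontr)
  assume ne: "\<O> v j \<noteq> \<O> w j"
  define D where "D = insert i {k. v k \<noteq> w k}"
  have jD: "j \<notin> D" using j const[OF v] const[OF w] by (simp add: D_def)
  obtain y where y0: "(\<forall>k. k \<notin> insert j D \<longrightarrow> y k = v k) \<and>
      (\<forall>k\<in>insert j D. \<O> y k = ((\<O> v)(j := \<O> w j)) k)"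
    by (rule exE[OF ex1_implies_ex[OF uso_ex1_pattern[OF uso]]])
  note y = y0[THEN conjunct1, rule_format] y0[THEN conjunct2, rule_format]
  have yD: "\<O> y k = \<O> v k" if "k \<in> D" for k
    using y(2)[of k] that jD by auto
  have yj: "\<O> y j = \<O> w j" using y(2)[of j] by simp
  have "y j \<noteq> v j"
  proof
    assume "y j = v j"
    then have "\<forall>k. k \<notin> D \<longrightarrow> y k = v k" using y(1) by (metis insertE)
    \<comment> \<open>On the face through \<open>v\<close> spanned by \<open>D\<close>, both
      \<open>y\<close> and \<open>v\<close> realize the pattern \<open>\<O> v\<close>.\<close>
    with yD have "y = v" using uso_ex1_pattern[OF uso, of D v "\<O> v"] by blast
    with yj ne show False by simp
  qed
  moreover have "y \<in> \<Union>P"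
  proof (rule phase_closed[OF P w])
    fix k assume k: "k \<noteq> i" "w k \<noteq> y k"
    show "\<O> w k = \<O> y k"
    proof (cases "k = j")
      case False
      \<comment> \<open>Outside \<open>insert j D\<close> the vertices \<open>y\<close> and
        \<open>v\<close> coincide, while inside \<open>D\<close>, away from \<open>i\<close>,
        \<open>v\<close> and \<open>w\<close> differ by definition. At \<open>j\<close> itself the
        outmap of \<open>y\<close> was prescribed to be that of \<open>w\<close>.\<close>
      with k y(1)[of k] have "v k \<noteq> w k" by (auto simp: D_def)
      with k agree[of k] yD[of k] show ?thesis by (simp add: D_def)
    qed (simp add: yj)
  qed
  ultimately show False using const v by metis
qed

theorem lemma19:
  fixes \<O> :: "('n::finite) outmap" and i :: 'n and P :: "'n edge set" and f :: "'n face"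
  assumes "uso \<O>"
    and "P \<in> phases \<O> i"
    and "minimal_face i P f"
  shows "\<forall>j. j \<notin> face_dim f \<longrightarrow> (\<forall>v\<in>\<Union>P. \<forall>w\<in>\<Union>P. \<O> v j = \<O> w j)"
proof (intro allI impI)
  fix j assume "j \<notin> face_dim f"
  then obtain c where c: "f j = Some c" by (auto simp: face_dim_def)
  have sub: "P \<subseteq> face_edges f i" using assms(3) by (simp add: minimal_face_def)
  have cube: "e \<in> cube_edges i" if "e \<in> P" for e
    using sub that by (auto simp: face_edges_def)
  have const: "x j = c" if x: "x \<in> \<Union>P" for x
  proof -
    have "x \<in> face_vertices f" using sub x by (auto simp: face_edges_def)
    from face_verticesD[OF this, of j] c show ?thesis by simp
  qed
  obtain e0 where e0: "e0 \<in> cube_edges i" "P = in_phase \<O> i `` {e0}"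
    using assms(2) by (auto simp: phases_def elim: quotientE)
  have e0P: "e0 \<in> P" using e0 by (simp add: in_phase_def)
  \<comment> \<open>An \<open>i\<close>-edge has endpoints on both sides of \<open>i\<close>, so
    \<open>i\<close> cannot be fixed to \<open>c\<close>.\<close>
  have j: "j \<noteq> i"
  proof
    assume "j = i"
    obtain u v where "e0 = {u, v}" "differ_exactly_in u v i"
      using e0(1) by (auto simp: cube_edges_def)
    moreover from this have "u i = c" "v i = c" using const e0P \<open>j = i\<close> by blast+
    ultimately show False by (auto simp: differ_exactly_in_def)
  qed
  have agree: "\<O> v j = \<O> w j"
    if "v \<in> \<Union>P" "w \<in> \<Union>P" "\<And>k. k \<noteq> i \<Longrightarrow> v k \<noteq> w k \<Longrightarrow> \<O> v k = \<O> w k" for v w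
    by (rule direct_phase_agree_outside_span[where c = c, OF assms(1,2) j]) (fact const that)+
  \<comment> \<open>Endpoints of one \<open>i\<close>-edge differ only in \<open>i\<close>, so the
    premise of \<open>agree\<close> is vacuous.\<close>
  have edge: "\<O> v j = \<O> w j" if "e \<in> P" "v \<in> e" "w \<in> e" for e v w
  proof (rule agree)
    fix k assume "k \<noteq> i" "v k \<noteq> w k"
    then show "\<O> v k = \<O> w k" using cube_edge_endpoints_agree[OF cube] that by metis
  qed (use that in auto)
  obtain v0 where v0: "v0 \<in> e0" using e0(1) by (auto simp: cube_edges_def)
  \<comment> \<open>The value at \<open>j\<close> is carried along a chain of direct phases from the
    representative \<open>e0\<close>. Membership in \<open>P\<close> is carried too, since
    \<open>agree\<close> applies only to endpoints of edges of \<open>P\<close>.\<close>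
  have "e \<in> P \<and> (\<forall>w\<in>e. \<O> v0 j = \<O> w j)" if "(e0, e) \<in> (direct_phase \<O> i)\<^sup>*" for e
    using that
  proof (induction rule: rtrancl_induct)
    case base
    show ?case using edge e0P v0 by blast
  next
    case (step e e')
    have "e' \<in> cube_edges i" using step.hyps by (auto simp: direct_phase_def)
    moreover have "(e0, e') \<in> (direct_phase \<O> i)\<^sup>*" using step.hyps by (rule rtrancl_into_rtrancl)
    ultimately have e': "e' \<in> P" using e0 by (simp add: in_phase_def)
    obtain v w where vw: "v \<in> e" "w \<in> e'"
      "\<And>k. k \<noteq> i \<Longrightarrow> v k \<noteq> w k \<Longrightarrow> \<O> v k = \<O> w k"
      using step.hyps(2) unfolding direct_phase_def by blast
    have "v \<in> \<Union>P" "w \<in> \<Union>P" using vw(1,2) e' step.IH by auto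
    then have "\<O> v j = \<O> w j" by (rule agree) (rule vw(3))
    then show ?case using vw(1,2) e' step.IH edge by metis
  qed
  then have "\<O> v0 j = \<O> w j" if "w \<in> \<Union>P" for w
    using that e0(2) by (auto simp: in_phase_def)
  then show "\<forall>v\<in>\<Union>P. \<forall>w\<in>\<Union>P. \<O> v j = \<O> w j" by metis
qed

end
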